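(* For every $0\le\delta\le1$, $$0\le D_4(\delta)<\log\frac{153}{100},\qquad A_4(\delta)>\gamma_4,$$ where $D_4,A_4,\gamma_4$ are defined as follows: $T_\delta:=1+\frac{2}{\log 2}-\delta$, $D_4(\delta):=\mathcal F_{S_+}(T_\delta)-\mathcal F_{S_4}(T_\delta)$, $A_4(\delta):=\log 2-D_4(\delta)$, and $\gamma_4:=\log\frac{200}{153}$.
   Context: Logarithms are natural. $S_+:=\{i\in\mathbb Z:i\ge-1\}$ and $S_4:=\{2,3,4,5\}$. For $S\in\{S_+,S_4\}$ and $T\in(2,5)$, $$\mathcal F_S(T):=\inf_{\lambda\in\mathbb R}\Big\{\log\sum_{i\in S}\exp\Big(\lambda i-\frac{\log 2}{2}i^2\Big)-\lambda T\Big\}.$$ For $0\le\delta\le1$ one has $T_\delta\in(2,5)$. *)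

theory Defs
  imports "HOL-Analysis.Analysis"
begin

definition S_plus :: "int set" where
  "S_plus = {i. i \<ge> -1}"

definition S_four :: "int set" where
  "S_four = {2, 3, 4, 5}"

(* The unordered sum converges for every set S of integers, because of the Gaussian weight.
   The infimum is taken in the reals, hence is meaningful only where the objective is bounded
   below in l; for both sets above and 2 < T < 5 this holds, as T lies between two
   elements of S. *)
definition free_energy :: "int set \<Rightarrow> real \<Rightarrow> real" where
  "free_energy S T =
     (INF l::real.
        ln (\<Sum>\<^sub>\<infinity>i\<in>S. exp (l * of_int i - ln 2 / 2 * (of_int i)\<^sup>2)) - l * T)"

definition T_param :: "real \<Rightarrow> real" where
  "T_param \<delta> = 1 + 2 / ln 2 - \<delta>"

definition D4 :: "real \<Rightarrow> real" where
  "D4 \<delta> = free_energy S_plus (T_param \<delta>) - free_energy S_four (T_param \<delta>)"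

definition A4 :: "real \<Rightarrow> real" where
  "A4 \<delta> = ln 2 - D4 \<delta>"

definition gamma4 :: real where
  "gamma4 = ln (200 / 153)"

end

(* For l between ln 4 and ln 24 the terms with index in {2, 3, 4, 5} dominate, so that
   Z_plus l <= 1.52 * Z_four l. For 2.8 <= T <= 4 the tilted mean on {2, 3, 4, 5} is below T at
   l = ln 4 and above T at l = ln 24, hence by convexity the infimum defining the restricted
   free energy may be taken over [ln 4, ln 24], and it is never necessary to locate the minimizer.
   The lower bound is Z_four <= Z_plus. *)

theory Submission
  imports Defs
begin

section \<open>Gaussian weights as monomials in \<open>exp l\<close>\<close>

definition weight :: "real \<Rightarrow> int \<Rightarrow> real" where
  "weight l i = exp (l * of_int i - ln 2 / 2 * (of_int i)\<^sup>2)"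

lemma weight_pos: "weight l i > 0"
  by (simp add: weight_def)

lemma exp_neg_half_ln2: "exp (- (ln 2 / 2)) = sqrt 2 / 2"
proof -
  have "exp (ln 2 / 2) = sqrt 2"
    using powr_half_sqrt[of 2] by (simp add: powr_def)
  then show ?thesis
    by (simp add: exp_minus field_simps)
qed

lemma sqrt2_bounds: "(1.414::real) < sqrt 2" "sqrt 2 < (1.4143::real)"
  by (rule real_less_rsqrt real_less_lsqrt; simp add: power2_eq_square)+

lemma weight_of_nat: "weight l (int n) = exp l ^ n * (sqrt 2 / 2) ^ (n\<^sup>2)"
proof -
  have "weight l (int n) = exp (real n * l) * exp (real (n\<^sup>2) * (- (ln 2 / 2)))"
    unfolding weight_def exp_add[symmetric] by (simp add: algebra_simps)
  then show ?thesis
    by (simp only: exp_of_nat_mult exp_neg_half_ln2)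
qed

text \<open>In this form the numerical estimates become rational inequalities in
  \<open>exp l\<close> with \<open>sqrt 2\<close> as the only irrational constant. It survives
  exactly at the odd indices, since the square of n has the parity of n.\<close>

lemma weight_values:
  shows "weight l (-1) = sqrt 2 / (2 * exp l)"
    and "weight l 0 = 1"
    and "weight l 1 = exp l * sqrt 2 / 2"
    and "weight l 2 = exp l ^ 2 / 4"
    and "weight l 3 = exp l ^ 3 * sqrt 2 / 32"
    and "weight l 4 = exp l ^ 4 / 256"
    and "weight l 5 = exp l ^ 5 * sqrt 2 / 8192"
    and "weight l 6 = exp l ^ 6 / 262144"
proof -
  have even_pow: "(sqrt 2 / 2) ^ (2 * k) = 1 / 2 ^ k" for k :: nat
    by (simp add: power_mult power_divide)
  have odd_pow: "(sqrt 2 / 2) ^ (2 * k + 1) = sqrt 2 / 2 ^ (k + 1)" for k :: nat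
    unfolding power_add even_pow by simp
  have "weight l (-1) = exp (- l) * exp (- (ln 2 / 2))"
    unfolding weight_def exp_add[symmetric] by simp
  then show "weight l (-1) = sqrt 2 / (2 * exp l)"
    by (simp only: exp_neg_half_ln2) (simp add: exp_minus field_simps)
  show "weight l 0 = 1"
    by (simp add: weight_def)
  show "weight l 1 = exp l * sqrt 2 / 2"
    using weight_of_nat[of l 1] by simp
  show "weight l 2 = exp l ^ 2 / 4"
    using weight_of_nat[of l 2] even_pow[of 2] by simp
  show "weight l 3 = exp l ^ 3 * sqrt 2 / 32"
    using weight_of_nat[of l 3] odd_pow[of 4] by simp
  show "weight l 4 = exp l ^ 4 / 256"
    using weight_of_nat[of l 4] even_pow[of 8] by simp
  show "weight l 5 = exp l ^ 5 * sqrt 2 / 8192"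
    using weight_of_nat[of l 5] odd_pow[of 12] by simp
  show "weight l 6 = exp l ^ 6 / 262144"
    using weight_of_nat[of l 6] even_pow[of 18] by simp
qed

section \<open>Convergence and the right tail\<close>

lemma weight_summable_atLeast: "weight l summable_on {k..}"
proof -
  define h where "h n = int n + k" for n
  have "bij_betw h UNIV {k..}"
    unfolding h_def by (rule bij_betwI[where g = "\<lambda>i. nat (i - k)"]) auto
  moreover have "(\<lambda>n. weight l (h n)) summable_on UNIV"
  proof -
    \<comment> \<open>Completing the square around \<open>l + 1\<close> instead of \<open>l\<close>
      leaves a spare \<open>- x\<close> in the exponent. With x = n + k this gives domination by a
      geometric series of ratio \<open>exp (- 1)\<close>.\<close>
    define C where "C = exp ((l + 1)\<^sup>2 / (2 * ln 2) - of_int k)"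
    have ln2: "ln 2 > (0::real)" by simp
    have bound: "weight l (h n) \<le> C * exp (- 1) ^ n" for n
    proof -
      define x :: real where "x = of_int (h n)"
      have "0 \<le> (ln 2 * x - (l + 1))\<^sup>2 / (2 * ln 2)"
        using ln2 by simp
      also have "\<dots> = ln 2 / 2 * x\<^sup>2 - (l + 1) * x + (l + 1)\<^sup>2 / (2 * ln 2)"
        using ln2 by (simp add: field_simps power2_eq_square)
      finally have "l * x - ln 2 / 2 * x\<^sup>2 \<le> (l + 1)\<^sup>2 / (2 * ln 2) - of_int k + real n * (- 1)"
        by (simp add: x_def h_def algebra_simps)
      then have "exp (l * x - ln 2 / 2 * x\<^sup>2)
          \<le> exp ((l + 1)\<^sup>2 / (2 * ln 2) - of_int k) * exp (real n * (- 1))"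
        unfolding exp_add[symmetric] by simp
      then show ?thesis
        by (simp only: exp_of_nat_mult weight_def C_def x_def)
    qed
    have "summable (\<lambda>n. C * exp (- 1 :: real) ^ n)"
      by (intro summable_mult summable_geometric) simp
    then have "summable (\<lambda>n. norm (weight l (h n)))"
      by (rule summable_comparison_test[rotated])
        (use bound weight_pos in \<open>auto simp: less_imp_le\<close>)
    then show ?thesis
      by (rule norm_summable_imp_summable_on)
  qed
  ultimately show ?thesis
    using summable_on_reindex_bij_betw by blast
qed

text \<open>The ratio of the weights at i + 1 and i is
  \<open>exp (l - (2 * i + 1) / 2 * ln 2)\<close>, which decreases in i, so the ratio
  \<open>q\<close> at i = 6 dominates the whole tail. For \<open>exp l \<le> 24\<close> it is below
  0.266, and 1 / (1 - 0.266) < 1.37.\<close>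

lemma weight_tail_le:
  assumes "exp l \<le> 24"
  shows "infsum (weight l) {6..} \<le> 1.37 * weight l 6"
proof -
  define h where "h n = int n + 6" for n
  have bij: "bij_betw h UNIV {6..}"
    unfolding h_def by (rule bij_betwI[where g = "\<lambda>i. nat (i - 6)"]) auto
  define q where "q = exp (l - 13 / 2 * ln 2)"
  have "q = exp l * (sqrt 2 / 2) ^ 13"
  proof -
    have "q = exp (l + real 13 * (- (ln 2 / 2)))"
      by (simp add: q_def)
    then show ?thesis
      by (simp only: exp_add exp_of_nat_mult exp_neg_half_ln2)
  qed
  moreover have "(sqrt 2 / 2) ^ 13 = sqrt 2 / (128::real)"
  proof -
    have "(sqrt 2 / 2) ^ 13 = ((sqrt 2 / 2)\<^sup>2) ^ 6 * (sqrt 2 / (2::real))"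
      unfolding power_mult[symmetric] power_Suc2[symmetric] by simp
    then show ?thesis
      by (simp add: power_divide)
  qed
  ultimately have "q \<le> 24 * (1.4143 / 128)"
    using sqrt2_bounds mult_mono[OF assms, of "sqrt 2 / 128" "1.4143 / 128"] by simp
  then have q: "0 < q" "q < 0.266"
    by (auto simp: q_def)
  have bound: "weight l (h n) \<le> weight l 6 * q ^ n" for n
  proof -
    \<comment> \<open>The exponent at 6 + n falls short of the geometric one by
      \<open>ln 2 / 2 * (n^2 - n)\<close>, which is nonnegative for natural n.\<close>
    have "real n \<le> (real n)\<^sup>2"
      by (cases n) (auto simp: power2_eq_square)
    then have "ln 2 / 2 * real n \<le> ln 2 / 2 * (real n)\<^sup>2"
      by (intro mult_left_mono) auto
    then have "l * of_int (h n) - ln 2 / 2 * (of_int (h n))\<^sup>2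
        \<le> (l * of_int 6 - ln 2 / 2 * (of_int 6)\<^sup>2) + real n * (l - 13 / 2 * ln 2)"
      by (simp add: h_def power2_eq_square algebra_simps)
    then show ?thesis
      unfolding weight_def q_def exp_of_nat_mult[symmetric] exp_add[symmetric] by simp
  qed
  have geo: "((\<lambda>n. weight l 6 * q ^ n) has_sum (weight l 6 * (1 / (1 - q)))) UNIV"
  proof (rule norm_summable_imp_has_sum)
    show "summable (\<lambda>n. norm (weight l 6 * q ^ n))"
      using q weight_pos[of l 6] by (auto simp: abs_mult power_abs intro!: summable_mult summable_geometric)
    show "(\<lambda>n. weight l 6 * q ^ n) sums (weight l 6 * (1 / (1 - q)))"
      using q by (intro sums_mult geometric_sums) auto
  qed
  have "infsum (weight l) {6..} = infsum (\<lambda>n. weight l (h n)) UNIV"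
    by (rule infsum_reindex_bij_betw[OF bij, symmetric])
  also have "\<dots> \<le> infsum (\<lambda>n. weight l 6 * q ^ n) UNIV"
  proof (rule infsum_mono)
    show "(\<lambda>n. weight l (h n)) summable_on UNIV"
      using weight_summable_atLeast summable_on_reindex_bij_betw[OF bij] by blast
    show "(\<lambda>n. weight l 6 * q ^ n) summable_on UNIV"
      using geo by (rule has_sum_imp_summable)
  qed (rule bound)
  also have "\<dots> = weight l 6 * (1 / (1 - q))"
    using geo by (rule infsumI)
  also have "\<dots> \<le> weight l 6 * 1.37"
    using q weight_pos[of l 6] by (intro mult_left_mono) (auto simp: field_simps)
  finally show ?thesis by simp
qed

section \<open>Comparison of the two partition functions\<close>

abbreviation Z_four :: "real \<Rightarrow> real" where
  "Z_four l \<equiv> sum (weight l) S_four"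

abbreviation Z_plus :: "real \<Rightarrow> real" where
  "Z_plus l \<equiv> infsum (weight l) S_plus"

lemma Z_four_pos: "Z_four l > 0"
  by (intro sum_pos weight_pos) (auto simp: S_four_def)

lemma free_energy_plus: "free_energy S_plus T = (INF l. ln (Z_plus l) - l * T)"
  by (simp add: free_energy_def weight_def[abs_def])

lemma free_energy_four: "free_energy S_four T = (INF l. ln (Z_four l) - l * T)"
  by (simp add: free_energy_def weight_def[abs_def] S_four_def)

lemma Z_plus_split:
  "Z_plus l = weight l (-1) + weight l 0 + weight l 1 + Z_four l + infsum (weight l) {6..}"
proof -
  have S: "S_plus = ({-1, 0, 1} \<union> S_four) \<union> {6..}"
    by (auto simp: S_plus_def S_four_def)
  have "Z_plus l = infsum (weight l) ({-1, 0, 1} \<union> S_four) + infsum (weight l) {6..}"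
    unfolding S by (rule infsum_Un_disjoint)
      (auto simp: S_four_def intro: weight_summable_atLeast)
  then show ?thesis
    by (simp add: S_four_def)
qed

lemma Z_four_le_Z_plus: "Z_four l \<le> Z_plus l"
  unfolding Z_plus_split
  using infsum_nonneg[of "{6..}" "weight l"] weight_pos[of l] by (simp add: less_imp_le add_nonneg_nonneg)

text \<open>Everything is divided by \<open>weight l 2\<close>, which is 4 u^2 for u =
  \<open>exp l / 4\<close> in [1, 6]. Then \<open>L\<close>, \<open>M\<close> and u^4 / 256 are the
  shares of the indices below 2, from 2 to 5, and 6, and the claim follows from
  \<open>L + 1.37 * (u ^ 4 / 256) \<le> 0.52 * M\<close>.\<close>

lemma Z_plus_le:
  assumes "4 \<le> exp l" "exp l \<le> 24"
  shows "Z_plus l \<le> 1.52 * Z_four l"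
proof -
  define s :: real where "s = sqrt 2"
  have s: "1.414 < s" "s < 1.4143"
    using sqrt2_bounds by (auto simp: s_def)
  define u where "u = exp l / 4"
  have exp_l: "exp l = 4 * u" by (simp add: u_def)
  have u: "1 \<le> u" "u \<le> 6" using assms by (auto simp: u_def)
  define v where "v = u - 1"
  have v: "0 \<le> v" "v \<le> 5" "u = 1 + v" using u by (auto simp: v_def)
  \<comment> \<open>The right side is the chord of the convex function 1 / u between u = 1 and u =
    6.\<close>
  have inv: "1 / u \<le> 1 - v / 6"
  proof -
    have "0 \<le> v * (5 - v)" using v by simp
    then have "1 \<le> (1 - v / 6) * u" unfolding v(3) by (simp add: algebra_simps)
    then show ?thesis using u by (simp add: field_simps)
  qed
  \<comment> \<open>As u >= 1, the higher inverse powers are at most 1 / u. The factor 2003 / 2000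
    exceeds the resulting coefficient 1.4143 * (1/2 + 1/32) + 1/4.\<close>
  have left: "s / (2 * u) + 1 / (4 * u\<^sup>2) + s / (32 * u ^ 3) \<le> (2003 / 2000) * (1 - v / 6)"
  proof -
    define a b c where "a = 1 / u" and "b = 1 / u\<^sup>2" and "c = 1 / u ^ 3"
    define d e where "d = s * a" and "e = s * c"
    have "b \<le> a" "c \<le> a"
      using u power_increasing[of 1 2 u] power_increasing[of 1 3 u]
      by (auto simp: a_def b_def c_def intro!: divide_left_mono)
    moreover have "d \<le> (14143 / 10000) * a" "e \<le> (14143 / 10000) * c"
      using s u unfolding a_def c_def d_def e_def by (intro mult_right_mono; simp)+
    moreover have "0 < a" "a \<le> 1 - v / 6"
      using u inv by (auto simp: a_def)
    ultimately have "d / 2 + b / 4 + e / 32 \<le> (2003 / 2000) * (1 - v / 6)"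
      by argo
    then show ?thesis
      by (simp add: a_def b_def c_def d_def e_def)
  qed
  have main: "(2003 / 2000) * (1 - v / 6) + 1.37 * (u ^ 4 / 256)
      \<le> 0.52 * (1 + s * u / 2 + u\<^sup>2 / 4 + s * u ^ 3 / 32)"
  proof -
    \<comment> \<open>Naming the monomials makes the inequality linear. After u^4 <= 6 u^3 the cubic
      terms are net positive on the left, so u^3 needs an upper bound, which v^3 <= 5 v^2 supplies.
      The constant terms leave a margin of only about 0.007.\<close>
    define a b c d where "a = s * u" and "b = s * u ^ 3" and "c = u ^ 3" and "d = v\<^sup>2"
    have "1.414 * u \<le> a" "1.414 * c \<le> b"
      using s u unfolding a_def b_def c_def by (intro mult_right_mono; simp)+
    moreover have "v ^ 3 \<le> 5 * d"
      using v mult_right_mono[of v 5 "v\<^sup>2"] by (simp add: d_def eval_nat_numeral)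
    then have "c \<le> 1 + 3 * v + 8 * d"
      unfolding c_def d_def v(3) by (simp add: algebra_simps eval_nat_numeral)
    moreover have "u ^ 4 \<le> 6 * c"
      using u mult_right_mono[of u 6 "u ^ 3"] by (simp add: c_def eval_nat_numeral)
    moreover have "u\<^sup>2 = 1 + 2 * v + d"
      unfolding v(3) d_def by (simp add: algebra_simps eval_nat_numeral)
    moreover have "0 \<le> d" by (simp add: d_def)
    ultimately show ?thesis
      unfolding a_def[symmetric] b_def[symmetric] using v
      by (simp add: field_simps)
  qed
  define L where "L = s / (2 * u) + 1 / (4 * u\<^sup>2) + s / (32 * u ^ 3)"
  define M where "M = 1 + s * u / 2 + u\<^sup>2 / 4 + s * u ^ 3 / 32"
  have "weight l (-1) + weight l 0 + weight l 1 = 4 * u\<^sup>2 * L"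
    using u unfolding weight_values exp_l s_def[symmetric] L_def
    by (simp add: field_simps eval_nat_numeral)
  moreover have "weight l 6 = 4 * u\<^sup>2 * (u ^ 4 / 256)"
    unfolding weight_values exp_l by (simp add: eval_nat_numeral)
  moreover have Z: "Z_four l = 4 * u\<^sup>2 * M"
    by (simp add: S_four_def weight_values exp_l s_def[symmetric] M_def algebra_simps eval_nat_numeral)
  ultimately have "Z_plus l \<le> 4 * u\<^sup>2 * (L + M + 1.37 * (u ^ 4 / 256))"
    unfolding Z_plus_split using weight_tail_le[OF assms(2)] by (simp add: algebra_simps)
  also have "L + M + 1.37 * (u ^ 4 / 256) \<le> 1.52 * M"
    using left main unfolding L_def[symmetric] M_def[symmetric] by (simp add: field_simps)
  then have "4 * u\<^sup>2 * (L + M + 1.37 * (u ^ 4 / 256)) \<le> 4 * u\<^sup>2 * (1.52 * M)"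
    by (intro mult_left_mono) auto
  finally show ?thesis
    by (simp add: Z)
qed

text \<open>The sum in the assumption has the sign of the derivative of the objective at \<open>l0\<close>;
  the proof uses convexity in the form \<open>1 + t \<le> exp t\<close>.\<close>

lemma objective_four_mono:
  assumes "0 \<le> (l - l0) * (\<Sum>i\<in>S_four. (of_int i - T) * weight l0 i)"
  shows "ln (Z_four l0) - l0 * T \<le> ln (Z_four l) - l * T"
proof -
  \<comment> \<open>The exponential of the objective is the sum of these products over
    \<open>S_four\<close>, so it suffices to compare such sums.\<close>
  have shift: "weight l i * exp (- l * T) = weight l0 i * exp (- l0 * T) * exp ((l - l0) * (of_int i - T))" for i
    unfolding weight_def exp_add[symmetric] by (simp add: algebra_simps)
  have "weight l0 i * exp (- l0 * T) * (1 + (l - l0) * (of_int i - T)) \<le> weight l i * exp (- l * T)" for i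
    unfolding shift using weight_pos[of l0 i] by (intro mult_left_mono exp_ge_add_one_self) auto
  then have "(\<Sum>i\<in>S_four. weight l0 i * exp (- l0 * T) * (1 + (l - l0) * (of_int i - T)))
      \<le> (\<Sum>i\<in>S_four. weight l i * exp (- l * T))"
    by (intro sum_mono)
  moreover have "(\<Sum>i\<in>S_four. weight l0 i * exp (- l0 * T) * (1 + (l - l0) * (of_int i - T)))
      = exp (- l0 * T) * (Z_four l0 + (l - l0) * (\<Sum>i\<in>S_four. (of_int i - T) * weight l0 i))"
    by (simp add: S_four_def algebra_simps)
  moreover have "exp (- l0 * T) * Z_four l0
      \<le> exp (- l0 * T) * (Z_four l0 + (l - l0) * (\<Sum>i\<in>S_four. (of_int i - T) * weight l0 i))"
    using assms by (intro mult_left_mono) auto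
  ultimately have "exp (- l0 * T) * Z_four l0 \<le> exp (- l * T) * Z_four l"
    unfolding sum_distrib_left by (simp add: mult.commute)
  then have "ln (exp (- l0 * T) * Z_four l0) \<le> ln (exp (- l * T) * Z_four l)"
    using Z_four_pos[of l0] by (intro ln_mono) auto
  then show ?thesis
    using Z_four_pos[of l0] Z_four_pos[of l] by (simp add: ln_mult)
qed

lemma objective_four_clamp:
  assumes "2.8 \<le> T" "T \<le> 4"
  shows "\<exists>l0. 4 \<le> exp l0 \<and> exp l0 \<le> 24 \<and> ln (Z_four l0) - l0 * T \<le> ln (Z_four l) - l * T"
proof -
  consider "l < ln 4" | "ln 4 \<le> l" "l \<le> ln 24" | "ln 24 < l" by linarith
  then show ?thesis
  proof cases
    case 1
    \<comment> \<open>The four weights at \<open>ln 4\<close> are 4, 2 sqrt 2, 1 and sqrt 2 / 8;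
      their mean index is about 2.67.\<close>
    have "(\<Sum>i\<in>S_four. of_int i * weight (ln 4) i) \<le> 2.8 * Z_four (ln 4)"
      using sqrt2_bounds by (simp add: S_four_def weight_values)
    also have "\<dots> \<le> T * Z_four (ln 4)"
      using assms Z_four_pos[of "ln 4"] by (intro mult_right_mono) auto
    finally have "(\<Sum>i\<in>S_four. (of_int i - T) * weight (ln 4) i) \<le> 0"
      by (simp add: left_diff_distrib sum_subtractf sum_distrib_left)
    with 1 show ?thesis
      by (intro exI[of _ "ln 4"]) (auto intro!: objective_four_mono mult_nonpos_nonpos)
  next
    case 2
    then show ?thesis
      by (intro exI[of _ l]) (auto simp flip: ln_le_cancel_iff)
  next
    case 3
    have "T * Z_four (ln 24) \<le> 4 * Z_four (ln 24)"
      using assms Z_four_pos[of "ln 24"] by (intro mult_right_mono) auto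
    \<comment> \<open>The weights at \<open>ln 24\<close> are proportional to 1, 3 sqrt 2, 9 and 27
      sqrt 2 / 4; their mean index is about 4.14.\<close>
    also have "\<dots> \<le> (\<Sum>i\<in>S_four. of_int i * weight (ln 24) i)"
      using sqrt2_bounds by (simp add: S_four_def weight_values)
    finally have "0 \<le> (\<Sum>i\<in>S_four. (of_int i - T) * weight (ln 24) i)"
      by (simp add: left_diff_distrib sum_subtractf sum_distrib_left)
    with 3 show ?thesis
      by (intro exI[of _ "ln 24"]) (auto intro!: objective_four_mono mult_nonneg_nonneg)
  qed
qed

text \<open>This makes the real infima meaningful. A single summand suffices: index 5 for l >= 0 and
  index 2 for l < 0 make \<open>l * (i - T)\<close> nonnegative, and the quadratic term costs at
  most \<open>25 / 2 * ln 2\<close>.\<close>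

lemma objective_four_bounded_below:
  assumes "2 \<le> T" "T \<le> 5"
  shows "- (25 / 2 * ln 2) \<le> ln (Z_four l) - l * T"
proof -
  have bound: "- (25 / 2 * ln 2) \<le> ln (Z_four l) - l * T"
    if "i \<in> S_four" "0 \<le> l * (of_int i - T)" for i
  proof -
    have "weight l i \<le> Z_four l"
      using that weight_pos[of l] by (intro member_le_sum) (auto simp: S_four_def less_imp_le)
    then have "ln (weight l i) \<le> ln (Z_four l)"
      using weight_pos[of l i] by (intro ln_mono) auto
    moreover have "ln 2 / 2 * (of_int i)\<^sup>2 \<le> ln 2 / 2 * (25::real)"
      using that(1) by (intro mult_left_mono) (auto simp: S_four_def)
    moreover have "ln (weight l i) = l * of_int i - ln 2 / 2 * (of_int i)\<^sup>2"
      by (simp add: weight_def)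
    ultimately show ?thesis
      using that(2) unfolding right_diff_distrib by linarith
  qed
  show ?thesis
  proof (cases "0 \<le> l")
    case True
    then show ?thesis using assms by (intro bound[of 5]) (auto simp: S_four_def)
  next
    case False
    then show ?thesis using assms by (intro bound[of 2]) (auto simp: S_four_def mult_nonpos_nonpos)
  qed
qed

section \<open>Passage to the infima\<close>

theorem lemma5p1:
  fixes \<delta> :: real
  assumes "0 \<le> \<delta>" and "\<delta> \<le> 1"
  shows "0 \<le> D4 \<delta> \<and> D4 \<delta> < ln (153 / 100) \<and> A4 \<delta> > gamma4"
proof -
  define T where "T = T_param \<delta>"
  have "(2.8::real) \<le> 2 / ln 2" "2 / ln 2 \<le> (3::real)"
    using ln2_le_25_over_36 ln2_ge_two_thirds by (auto simp: field_simps)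
  then have T: "2.8 \<le> T" "T \<le> 4"
    using assms by (auto simp: T_def T_param_def)
  have ln_le: "ln (Z_four l) \<le> ln (Z_plus l)" for l
    using Z_four_le_Z_plus Z_four_pos by (rule ln_mono)
  have bdd_four: "bdd_below (range (\<lambda>l. ln (Z_four l) - l * T))"
    using objective_four_bounded_below[of T] T
    by (intro bdd_belowI2[where m = "- (25 / 2 * ln 2)"]) auto
  have bdd_plus: "bdd_below (range (\<lambda>l. ln (Z_plus l) - l * T))"
  proof (rule bdd_belowI2)
    show "- (25 / 2 * ln 2) \<le> ln (Z_plus l) - l * T" for l
      using objective_four_bounded_below[of T l] T ln_le[of l] by linarith
  qed
  have "free_energy S_four T \<le> free_energy S_plus T"
    unfolding free_energy_four free_energy_plus
    using bdd_four ln_le by (intro cINF_mono) (auto intro: diff_right_mono)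
  then have lower: "0 \<le> D4 \<delta>"
    by (simp add: D4_def T_def)
  \<comment> \<open>The full objective is evaluated at the clamped point \<open>l0\<close>, not at
    \<open>l\<close>: there the ratio bound applies, and the restricted objective is no larger than
    at \<open>l\<close>.\<close>
  have "free_energy S_plus T - ln 1.52 \<le> ln (Z_four l) - l * T" for l
  proof -
    obtain l0 where l0: "4 \<le> exp l0" "exp l0 \<le> 24"
      "ln (Z_four l0) - l0 * T \<le> ln (Z_four l) - l * T"
      using objective_four_clamp[OF T] by blast
    have "free_energy S_plus T \<le> ln (Z_plus l0) - l0 * T"
      unfolding free_energy_plus using bdd_plus by (intro cINF_lower) auto
    also have "ln (Z_plus l0) \<le> ln (1.52 * Z_four l0)"
      using Z_plus_le[OF l0(1,2)] Z_four_pos[of l0] Z_four_le_Z_plus[of l0] by (intro ln_mono) auto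
    also have "\<dots> = ln 1.52 + ln (Z_four l0)"
      using Z_four_pos[of l0] by (intro ln_mult_pos) auto
    finally show ?thesis using l0(3) by simp
  qed
  then have "free_energy S_plus T - ln 1.52 \<le> free_energy S_four T"
    unfolding free_energy_four by (intro cINF_greatest) auto
  \<comment> \<open>Passing to the infimum keeps only a weak inequality; the gap between 1.52 and
    1.53 makes the bound strict.\<close>
  moreover have "ln 1.52 < ln (153 / 100 :: real)"
    by simp
  ultimately have upper: "D4 \<delta> < ln (153 / 100)"
    unfolding D4_def T_def by linarith
  have "ln 2 - ln (153 / 100) = gamma4"
    using ln_div[of 2 "153 / 100 :: real"] by (simp add: gamma4_def)
  with lower upper show ?thesis
    by (auto simp: A4_def)
qed

end
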